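(* Let $m,n\ge 1$ be integers, let $k>0$, and let $\mathcal{G}$ be a weighted digraph on the node set $\{1,\dots,m\}$ with weighted adjacency matrix $A=(a_{ij})\in\mathbf{R}^{m\times m}$. Consider the high-dimensional Kuramoto model with identical oscillators on the unit sphere of $\mathbf{R}^n$, $$\dot r_i = k\sum_{j=1}^m a_{ij}\bigl(r_j-(r_i^{T}r_j)\,r_i\bigr),\qquad i=1,2,\dots,m,$$ where $r_i(t)\in\mathbf{R}^n$ and $\|r_i(t)\|=1$. Assume that $\mathcal{G}$ has a directed spanning tree and that the initial states are such that there exists $v\in\mathbf{R}^n$ with $v^{T}r_i(0)>0$ for every $i=1,2,\dots,m$. Then exponential synchronization is achieved: there exist a constant $\mu>0$ and a real-valued function $\alpha(r(0))$ of the initial states $r(0)=(r_1(0),\dots,r_m(0))$ (ranging over the $m$-tuples of unit vectors for which such a $v$ exists) such that for all such initial states $$\|r_i(t)-r_j(t)\|\le \alpha(r(0))\,e^{-\mu t}\qquad \text{for all } t\ge 0 \text{ and all } i,j=1,2,\dots,m.$$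
   Context: The weighted digraph $\mathcal{G}=(\mathcal{V},\mathcal{E},A)$ has nodes $\mathcal{V}=\{1,\dots,m\}$, edge set $\mathcal{E}\subset\mathcal{V}\times\mathcal{V}$, and weighted adjacency matrix $A=(a_{ij})$ with $a_{ij}>0$ if $(j,i)\in\mathcal{E}$ and $a_{ij}=0$ otherwise (the edge $(j,i)$ means that information of node $j$ is transmitted to node $i$). A path from $k_1$ to $k_s$ is a sequence of directed edges $(k_1,k_2),(k_2,k_3),\dots,(k_{s-1},k_s)$. $\mathcal{G}$ has a directed spanning tree if and only if it has a root node, i.e. a node $v_0$ such that for any other node $i$ there is a directed path from $v_0$ to $i$. The dynamics preserves the unit sphere, and all states are taken on the unit sphere. $\|\cdot\|$ is the Euclidean norm. *)

theory Defs
  imports "HOL-Analysis.Analysis"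
begin

text \<open>
  The node set of every digraph is the whole finite index type; an edge is a pair (source, target).
  The entry in row \<open>i\<close> and column \<open>j\<close> is the weight of the edge from \<open>j\<close> to \<open>i\<close>.
\<close>

definition weighted_digraph :: "('m::finite \<times> 'm) set \<Rightarrow> real^'m^'m \<Rightarrow> bool" where
  "weighted_digraph E A \<longleftrightarrow>
     (\<forall>i j. ((j, i) \<in> E \<longrightarrow> A $ i $ j > 0) \<and> ((j, i) \<notin> E \<longrightarrow> A $ i $ j = 0))"

definition root_node :: "('m \<times> 'm) set \<Rightarrow> 'm \<Rightarrow> bool" where
  "root_node E v0 \<longleftrightarrow> (\<forall>i. i \<noteq> v0 \<longrightarrow> (v0, i) \<in> E\<^sup>+)"

definition directed_tree :: "('m \<times> 'm) set \<Rightarrow> 'm \<Rightarrow> bool" where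
  "directed_tree T v0 \<longleftrightarrow>
     (\<forall>j. (j, v0) \<notin> T) \<and> (\<forall>i. i \<noteq> v0 \<longrightarrow> (\<exists>!j. (j, i) \<in> T)) \<and> root_node T v0"

definition has_directed_spanning_tree :: "('m \<times> 'm) set \<Rightarrow> bool" where
  "has_directed_spanning_tree E \<longleftrightarrow> (\<exists>T v0. T \<subseteq> E \<and> directed_tree T v0)"

lemma root_node_imp_spanning_tree:
  assumes "root_node E v0"
  shows "\<exists>T\<subseteq>E. directed_tree T v0"
proof -
  define d where "d i = (LEAST n. (v0, i) \<in> E ^^ n)" for i
  have reach: "(v0, i) \<in> E ^^ d i" for i
  proof -
    have "(v0, i) \<in> E\<^sup>*"
      using assms unfolding root_node_def by (cases "i = v0") (auto simp: trancl_into_rtrancl)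
    then obtain n where "(v0, i) \<in> E ^^ n"
      by (auto dest: rtrancl_imp_relpow)
    then show ?thesis
      unfolding d_def by (rule LeastI)
  qed
  have "\<exists>j. (j, i) \<in> E \<and> d j < d i" if "i \<noteq> v0" for i
  proof (cases "d i")
    case 0
    then show ?thesis using reach[of i] that by simp
  next
    case (Suc n)
    then obtain j where j: "(v0, j) \<in> E ^^ n" "(j, i) \<in> E"
      using reach[of i] by auto
    have "d j \<le> n"
      unfolding d_def by (rule Least_le) (rule j)
    then show ?thesis using j Suc by auto
  qed
  then obtain p where p: "\<And>i. i \<noteq> v0 \<Longrightarrow> (p i, i) \<in> E" "\<And>i. i \<noteq> v0 \<Longrightarrow> d (p i) < d i"
    by metis
  define T where "T = {(p i, i) | i. i \<noteq> v0}"
  have "(v0, i) \<in> T\<^sup>*" for i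
  proof (induction "d i" arbitrary: i rule: less_induct)
    case less
    show ?case
    proof (cases "i = v0")
      case False
      then have "(v0, p i) \<in> T\<^sup>*" using less p by blast
      moreover have "(p i, i) \<in> T" using False by (auto simp: T_def)
      ultimately show ?thesis by (rule rtrancl_into_rtrancl)
    qed simp
  qed
  then have "root_node T v0"
    unfolding root_node_def by (metis rtranclD)
  moreover have "\<exists>!j. (j, i) \<in> T" if "i \<noteq> v0" for i
    using that by (auto simp: T_def)
  moreover have "(j, v0) \<notin> T" for j
    by (auto simp: T_def)
  ultimately have "directed_tree T v0"
    unfolding directed_tree_def by blast
  moreover have "T \<subseteq> E"
    using p by (auto simp: T_def)
  ultimately show ?thesis by blast
qed

lemma has_directed_spanning_tree_iff_root_node:
  "has_directed_spanning_tree E \<longleftrightarrow> (\<exists>v0. root_node E v0)"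
proof
  assume "has_directed_spanning_tree E"
  then obtain T v0 where "T \<subseteq> E" "root_node T v0"
    unfolding has_directed_spanning_tree_def directed_tree_def by blast
  then have "root_node E v0"
    unfolding root_node_def using trancl_mono[OF _ \<open>T \<subseteq> E\<close>] by simp
  then show "\<exists>v0. root_node E v0" ..
next
  assume "\<exists>v0. root_node E v0"
  then obtain v0 where "root_node E v0" ..
  from root_node_imp_spanning_tree[OF this] show "has_directed_spanning_tree E"
    unfolding has_directed_spanning_tree_def by auto
qed

text \<open>
  A trajectory on \<open>[0, \<infinity>)\<close>, with the one-sided derivative at time \<open>0\<close>;
  component \<open>i\<close> of the tuple \<open>r t\<close> is the state of oscillator \<open>i\<close>.
\<close>

definition kuramoto_solution ::
    "real \<Rightarrow> real^'m^'m \<Rightarrow> (real \<Rightarrow> (real^'n)^'m) \<Rightarrow> bool" where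
  "kuramoto_solution k A r \<longleftrightarrow>
     (\<forall>t\<ge>0. \<forall>i. norm (r t $ i) = 1 \<and>
        ((\<lambda>s. r s $ i) has_vector_derivative
           k *\<^sub>R (\<Sum>j\<in>UNIV. A $ i $ j *\<^sub>R (r t $ j - (r t $ i \<bullet> r t $ j) *\<^sub>R r t $ i)))
          (at t within {0..}))"

end

theory Submission
  imports Defs
begin

text \<open>
  The heights \<open>h\<^sub>i = v \<bullet> r\<^sub>i\<close> above the hyperplane orthogonal to a unit vector \<open>v\<close> satisfy
  \<open>h\<^sub>i' = k \<Sum>\<^sub>j a\<^sub>i\<^sub>j (h\<^sub>j - (r\<^sub>i \<bullet> r\<^sub>j) h\<^sub>i)\<close>. Since \<open>r\<^sub>i \<bullet> r\<^sub>j \<le> 1\<close>, a lowest oscillator with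
  positive height cannot sink, so heights that start at \<open>\<delta> > 0\<close> or more stay in \<open>[\<delta>, 1]\<close>
  (\<open>kuramoto_hemisphere_invariant\<close>). The gnomonic projection \<open>x\<^sub>i = r\<^sub>i / h\<^sub>i\<close> is therefore defined
  for all times, and it makes the nonlinearity disappear into the weights: the terms with
  \<open>r\<^sub>i \<bullet> r\<^sub>j\<close> cancel in the quotient rule and leave the linear consensus system
  \<open>x\<^sub>i' = \<Sum>\<^sub>j b\<^sub>i\<^sub>j(t) (x\<^sub>j - x\<^sub>i)\<close> with \<open>b\<^sub>i\<^sub>j = k a\<^sub>i\<^sub>j h\<^sub>j / h\<^sub>i\<close>
  (\<open>kuramoto_gnomonic_consensus\<close>). On the edges these weights lie between two positive constants
  that depend only on \<open>\<delta>\<close>, \<open>k\<close> and \<open>A\<close>.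

  For such a system every linear functional of the state has nonincreasing spread. Within one unit
  of time the root node pulls every node away from the minimum by a fixed fraction of the root's own
  distance to it, and likewise from the maximum; the two distances add up to the spread, so the
  spread shrinks by a fixed factor
  (\<open>consensus_contraction\<close>). Iteration gives exponential decay of \<open>x\<^sub>i - x\<^sub>j\<close>, and normalisation
  does not increase distances outside the unit ball, so \<open>r\<^sub>i - r\<^sub>j\<close> decays at least as fast
  (\<open>kuramoto_rate_on_cap\<close>).

  The rate obtained in this way degenerates as \<open>\<delta> \<rightarrow> 0\<close>, whereas \<open>\<mu>\<close> has to serve all initial states.
  The remedy is a restart. After a time \<open>T\<close> that depends on the initial state only through \<open>\<delta>\<close>, all
  mutual distances are at most \<open>1\<close>. From then on the position of any one oscillator at time \<open>T\<close> can
  take the role of \<open>v\<close>, with \<open>\<delta> = 1/2\<close>. So the rate for \<open>\<delta> = 1/2\<close> is the rate for every initial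
  state, and the delay \<open>T\<close> only enlarges the constant factor (\<open>kuramoto_uniform_rate\<close>).
\<close>

section \<open>A minimum principle\<close>

text \<open>
  Adding the strictly increasing drift \<open>e (1 + s)\<close> turns the weak condition on the derivative into a
  strict one: at the first time at which some perturbed component vanishes, that component is a
  minimum and has positive derivative, so it was already negative shortly before. The condition is
  imposed only for values in \<open>(-\<eta>, 0)\<close>, because the height equation on the sphere is inward pointing
  only as long as the heights are positive.
\<close>

lemma minimum_principle:
  fixes u :: "real \<Rightarrow> 'm::finite \<Rightarrow> real"
  assumes deriv: "\<And>t i. t \<ge> 0 \<Longrightarrow> ((\<lambda>s. u s i) has_real_derivative u' t i) (at t within {0..})"
    and "\<eta> > 0"
    and inward: "\<And>t i. \<lbrakk>t \<ge> 0; - \<eta> < u t i; u t i < 0; \<forall>j. u t i \<le> u t j\<rbrakk> \<Longrightarrow> u' t i \<ge> 0"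
    and init: "\<And>i. u 0 i \<ge> 0"
    and "t \<ge> 0"
  shows "u t i \<ge> 0"
proof (rule ccontr)
  assume "\<not> u t i \<ge> 0"
  \<comment> \<open>Small enough that the drift neither lifts the component \<open>i\<close> above \<open>0\<close> by time \<open>t\<close> nor takes the
    crossing value \<open>- e (1 + s)\<close> out of the range \<open>(-\<eta>, 0)\<close>.\<close>
  define e where "e = min (- u t i) (\<eta>/2) / (1 + t)"
  have e: "e > 0" "e * (1 + t) \<le> - u t i" "e * (1 + t) < \<eta>"
    using \<open>t \<ge> 0\<close> \<open>\<eta> > 0\<close> \<open>\<not> u t i \<ge> 0\<close> unfolding e_def by (auto simp: min_def)
  define w where "w s j = u s j + e * (1 + s)" for s j
  have w': "((\<lambda>s. w s j) has_real_derivative u' s j + e) (at s within {0..})" if "s \<ge> 0" for s j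
    unfolding w_def by (auto intro!: derivative_eq_intros deriv that)
  have cont: "continuous_on {0..t} (\<lambda>s. w s j)" for j
    by (rule continuous_on_subset[of "{0..}"]) (auto intro!: DERIV_continuous_on w')
  define S where "S = (\<Union>j. {s \<in> {0..t}. w s j \<le> 0})"
  have "closed S"
    unfolding S_def
    by (intro closed_UN ballI finite_class.finite_UNIV continuous_on_closed_Collect_le cont
        continuous_on_const closed_atLeastAtMost)
  moreover have "t \<in> S" using e(2) \<open>t \<ge> 0\<close> by (auto simp: S_def w_def intro!: exI[of _ i])
  moreover have bdd: "bdd_below S" unfolding S_def by (rule bdd_belowI[of _ 0]) auto
  ultimately have InfS: "Inf S \<in> S" using closed_contains_Inf by blast
  define s where "s = Inf S"
  obtain j where j: "0 \<le> s" "s \<le> t" "w s j \<le> 0" using InfS unfolding s_def S_def by auto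
  have before: "w x l > 0" if "0 \<le> x" "x < s" for x l
  proof (rule ccontr)
    assume "\<not> w x l > 0"
    then have "x \<in> S" using that j unfolding S_def by (auto simp: not_less intro!: exI[of _ l])
    from cInf_lower[OF this bdd] that show False by (simp add: s_def)
  qed
  have "w 0 l > 0" for l using init[of l] e(1) by (simp add: w_def)
  with j have "s > 0" by (metis leD order_le_less)
  have at_s: "w s l \<ge> 0" for l
  proof (rule tendsto_lowerbound)
    show "((\<lambda>x. w x l) \<longlongrightarrow> w s l) (at s within {0..<s})"
      using DERIV_continuous[OF w'[OF j(1)], of l] unfolding continuous_within
      by (rule tendsto_within_subset) auto
    show "\<forall>\<^sub>F x in at s within {0..<s}. 0 \<le> w x l"
      using before by (auto simp: eventually_at_filter intro!: always_eventually less_imp_le)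
    show "at s within {0..<s} \<noteq> bot"
      using \<open>s > 0\<close> by (simp add: trivial_limit_within islimpt_in_closure)
  qed
  have ws: "w s j = 0" using at_s[of j] j by linarith
  have us: "u s j = - (e * (1 + s))" using ws by (simp add: w_def)
  have "u' s j \<ge> 0"
  proof (rule inward)
    have "e * (1 + s) \<le> e * (1 + t)" using e(1) j(2) by simp
    then show "- \<eta> < u s j" using us e(3) by linarith
    show "u s j < 0" unfolding us using e(1) j(1) by simp
    show "\<forall>l. u s j \<le> u s l"
    proof
      show "u s j \<le> u s l" for l using at_s[of l] ws by (simp add: w_def)
    qed
  qed (use j in auto)
  with e(1) have "u' s j + e > 0" by simp
  from has_real_derivative_pos_inc_left[OF w'[OF j(1)] this]
  obtain d where d: "d > 0" "\<And>x. x > 0 \<Longrightarrow> s - x \<ge> 0 \<Longrightarrow> x < d \<Longrightarrow> w (s - x) j < w s j"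
    by auto
  have "w (s - min s (d/2)) j < 0"
    using d(2)[of "min s (d/2)"] d(1) \<open>s > 0\<close> ws by (auto simp: min_def split: if_splits)
  moreover have "w (s - min s (d/2)) j > 0"
    using before[of "s - min s (d/2)" j] d(1) \<open>s > 0\<close> by (auto simp: min_def split: if_splits)
  ultimately show False by simp
qed

section \<open>Linear consensus with time-varying weights\<close>

definition consensus ::
    "(real \<Rightarrow> 'm::finite \<Rightarrow> 'm \<Rightarrow> real) \<Rightarrow> (real \<Rightarrow> 'm \<Rightarrow> real) \<Rightarrow> bool" where
  "consensus b y \<longleftrightarrow> (\<forall>t\<ge>0. \<forall>i.
     ((\<lambda>s. y s i) has_real_derivative (\<Sum>j\<in>UNIV. b t i j * (y t j - y t i))) (at t within {0..}))"

text \<open>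
  The index order follows the adjacency matrix: \<open>b t i j\<close> is the weight of the edge from \<open>j\<close> to \<open>i\<close>.
  The set \<open>E\<close> collects the edges whose coupling is guaranteed at all times; it need not be the full support.
\<close>

definition weights_between ::
    "('m \<times> 'm) set \<Rightarrow> real \<Rightarrow> real \<Rightarrow> (real \<Rightarrow> 'm \<Rightarrow> 'm \<Rightarrow> real) \<Rightarrow> bool" where
  "weights_between E lo hi b \<longleftrightarrow>
     (\<forall>t\<ge>0. \<forall>i j. 0 \<le> b t i j \<and> b t i j \<le> hi \<and> ((j, i) \<in> E \<longrightarrow> lo \<le> b t i j))"

lemma consensusD:
  assumes "consensus b y" "t \<ge> 0"
  shows "((\<lambda>s. y s i) has_real_derivative (\<Sum>j\<in>UNIV. b t i j * (y t j - y t i))) (at t within {0..})"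
  using assms by (auto simp: consensus_def)

lemma consensus_add_const:
  assumes "consensus b y"
  shows "consensus b (\<lambda>t i. y t i + c)"
  unfolding consensus_def by (auto intro!: derivative_eq_intros consensusD[OF assms])

lemma consensus_uminus:
  assumes "consensus b y"
  shows "consensus b (\<lambda>t i. - y t i)"
  unfolding consensus_def
  by (auto intro!: derivative_eq_intros consensusD[OF assms] simp: sum_negf[symmetric] algebra_simps)

lemma has_vector_derivative_shift_halfline:
  fixes f :: "real \<Rightarrow> 'a::real_normed_vector"
  assumes "(f has_vector_derivative D) (at (a + t) within {0..})" "a \<ge> 0"
  shows "((\<lambda>s. f (a + s)) has_vector_derivative D) (at t within {0..})"
proof -
  have "((\<lambda>s. a + s) has_vector_derivative 1) (at t within {0..})"
    by (auto intro!: derivative_eq_intros)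
  moreover have "(f has_vector_derivative D) (at (a + t) within ((\<lambda>s. a + s) ` {0..}))"
    by (rule has_vector_derivative_within_subset[OF assms(1)]) (use assms(2) in auto)
  ultimately show ?thesis
    using vector_diff_chain_within[of "\<lambda>s. a + s" 1 t "{0..}" f D] by (simp add: o_def)
qed

lemma consensus_shift:
  assumes "consensus b y" "a \<ge> 0"
  shows "consensus (\<lambda>t. b (a + t)) (\<lambda>t. y (a + t))"
  using assms unfolding consensus_def has_real_derivative_iff_has_vector_derivative
  by (auto intro: has_vector_derivative_shift_halfline)

lemma weights_between_shift:
  assumes "weights_between E lo hi b" "a \<ge> 0"
  shows "weights_between E lo hi (\<lambda>t. b (a + t))"
  using assms by (auto simp: weights_between_def)

lemma consensus_lower_bound:
  assumes "consensus b y" "weights_between E lo hi b" "\<And>i. y 0 i \<ge> c" "t \<ge> 0"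
  shows "y t i \<ge> c"
proof -
  have "y t i + (- c) \<ge> 0"
  proof (rule minimum_principle[where \<eta> = 1 and u = "\<lambda>t i. y t i + (- c)"])
    show "((\<lambda>s. y s i + - c) has_real_derivative (\<Sum>j\<in>UNIV. b t i j * (y t j - y t i))) (at t within {0..})"
      if "t \<ge> 0" for t i
      using consensusD[OF consensus_add_const[OF assms(1), of "- c"] that, of i] by simp
    show "0 \<le> (\<Sum>j\<in>UNIV. b t i j * (y t j - y t i))"
      if "t \<ge> 0" "\<forall>j. y t i + - c \<le> y t j + - c" for t i
      using that assms(2) by (intro sum_nonneg mult_nonneg_nonneg) (auto simp: weights_between_def)
  qed (use assms in auto)
  then show ?thesis by simp
qed

lemma consensus_upper_bound:
  assumes "consensus b y" "weights_between E lo hi b" "\<And>i. y 0 i \<le> c" "t \<ge> 0"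
  shows "y t i \<le> c"
  using consensus_lower_bound[OF consensus_uminus[OF assms(1)] assms(2), of "- c" t i] assms(3,4)
  by simp

lemma nonneg_of_derivative_nonneg:
  fixes f :: "real \<Rightarrow> real"
  assumes "\<And>s. s \<ge> 0 \<Longrightarrow> (f has_real_derivative f' s) (at s within {0..})"
    and "\<And>s. s \<ge> 0 \<Longrightarrow> f' s \<ge> 0" and "f 0 \<ge> 0" and "t \<ge> 0"
  shows "f t \<ge> 0"
proof -
  have "f 0 \<le> f t"
  proof (rule DERIV_nonneg_imp_increasing_open[OF assms(4)])
    show "\<exists>D. (f has_real_derivative D) (at x) \<and> D \<ge> 0" if "0 < x" "x < t" for x
    proof -
      have "at x within {0..} = at x" using that by (intro at_within_interior) auto
      then show ?thesis using assms(1,2)[of x] that by auto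
    qed
    show "continuous_on {0..t} f"
      by (rule continuous_on_subset[of "{0..}"]) (auto intro!: DERIV_continuous_on assms(1))
  qed
  then show ?thesis using assms(3) by simp
qed

text \<open>
  The constant \<open>K = CARD('m) * hi\<close> dominates the total weight into any node, so in
  \<open>z\<^sub>i = exp (K t) y\<^sub>i\<close> the loss term is compensated and \<open>z\<^sub>i' \<ge> b\<^sub>i\<^sub>j z\<^sub>j\<close> for every single \<open>j\<close>. Integrating this
  inequality once per edge of a path that starts in \<open>v\<close> gives one more factor \<open>lo * t\<close> and the
  factorial, exactly as in the Picard iteration for the exponential series.
\<close>

lemma consensus_path_growth:
  fixes b :: "real \<Rightarrow> 'm::finite \<Rightarrow> 'm \<Rightarrow> real"
  assumes cons: "consensus b y" and wt: "weights_between E lo hi b" and "lo \<ge> 0"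
    and nonneg: "\<And>i. y 0 i \<ge> 0"
    and path: "(v, i) \<in> E ^^ d" and "t \<ge> 0"
  shows "y 0 v * (lo * t) ^ d / fact d \<le> exp (real CARD('m) * hi * t) * y t i"
proof -
  define K where "K = real CARD('m) * hi"
  define z where "z s i = exp (K * s) * y s i" for s i
  define z' where "z' s i = (\<Sum>j\<in>UNIV. b s i j * z s j) + (K - (\<Sum>j\<in>UNIV. b s i j)) * z s i" for s i
  have z: "z s i \<ge> 0" if "s \<ge> 0" for s i
    using consensus_lower_bound[OF cons wt nonneg that] by (simp add: z_def)
  have deriv: "((\<lambda>s. z s i) has_real_derivative z' s i) (at s within {0..})" if "s \<ge> 0" for s i
    unfolding z_def z'_def
    by (auto intro!: derivative_eq_intros consensusD[OF cons that]
        simp: sum_distrib_left sum_distrib_right sum_subtractf algebra_simps)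
  have rest: "(K - (\<Sum>j\<in>UNIV. b s i j)) * z s i \<ge> 0" if "s \<ge> 0" for s i
  proof -
    have "(\<Sum>j\<in>UNIV. b s i j) \<le> (\<Sum>j\<in>(UNIV::'m set). hi)"
      using wt that by (intro sum_mono) (auto simp: weights_between_def)
    then show ?thesis using z[OF that] by (simp add: K_def)
  qed
  have bz: "b s i j * z s j \<ge> 0" if "s \<ge> 0" for s i j
    using z[OF that] wt that by (auto simp: weights_between_def)
  have z'_lower: "b s i j * z s j \<le> z' s i" if "s \<ge> 0" for s i j
    using member_le_sum[of j UNIV "\<lambda>j. b s i j * z s j"] bz[OF that] rest[OF that, of i]
    unfolding z'_def by simp
  show ?thesis
    using path \<open>t \<ge> 0\<close>
  proof (induction d arbitrary: i t)
    case 0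
    have "z t v - z 0 v \<ge> 0"
    proof (rule nonneg_of_derivative_nonneg[where f = "\<lambda>s. z s v - z 0 v" and f' = "\<lambda>s. z' s v"])
      show "((\<lambda>s. z s v - z 0 v) has_real_derivative z' s v) (at s within {0..})" if "s \<ge> 0" for s
        by (auto intro!: derivative_eq_intros deriv that)
      show "z' s v \<ge> 0" if "s \<ge> 0" for s
        using z'_lower[OF that, where j = v and i = v] bz[OF that, where j = v and i = v] by linarith
    qed (use 0 in auto)
    then show ?case using 0 by (simp add: z_def K_def)
  next
    case (Suc d)
    from Suc.prems obtain j where j: "(v, j) \<in> E ^^ d" "(j, i) \<in> E" by auto
    have "z t i - y 0 v * (lo * t) ^ Suc d / fact (Suc d) \<ge> 0"
    proof (rule nonneg_of_derivative_nonneg[where f = "\<lambda>s. z s i - y 0 v * (lo * s) ^ Suc d / fact (Suc d)"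
          and f' = "\<lambda>s. z' s i - lo * (y 0 v * (lo * s) ^ d / fact d)"])
      show "((\<lambda>s. z s i - y 0 v * (lo * s) ^ Suc d / fact (Suc d)) has_real_derivative
          z' s i - lo * (y 0 v * (lo * s) ^ d / fact d)) (at s within {0..})" if "s \<ge> 0" for s
      proof -
        have "((\<lambda>s. y 0 v * (lo * s) ^ Suc d / fact (Suc d)) has_real_derivative
           y 0 v * (real (Suc d) * (lo * s) ^ d * lo) / fact (Suc d)) (at s within {0..})"
          by (auto intro!: derivative_eq_intros simp del: power_Suc fact_Suc)
        also have "y 0 v * (real (Suc d) * (lo * s) ^ d * lo) / fact (Suc d) = lo * (y 0 v * (lo * s) ^ d / fact d)"
          by (simp add: divide_simps)
        finally show ?thesis by (intro DERIV_diff deriv that)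
      qed
      show "0 \<le> z' s i - lo * (y 0 v * (lo * s) ^ d / fact d)" if "s \<ge> 0" for s
      proof -
        have "lo * (y 0 v * (lo * s) ^ d / fact d) \<le> lo * z s j"
          using Suc.IH[OF j(1) that] \<open>lo \<ge> 0\<close> unfolding z_def K_def by (rule mult_left_mono)
        also have "\<dots> \<le> b s i j * z s j"
          using wt j(2) that z[OF that] by (intro mult_right_mono) (auto simp: weights_between_def)
        also have "\<dots> \<le> z' s i" by (rule z'_lower[OF that])
        finally show ?thesis by simp
      qed
    qed (use Suc.prems nonneg in \<open>auto simp: z_def\<close>)
    then show ?case by (simp add: z_def K_def)
  qed
qed

lemma root_node_relpow:
  assumes "root_node E v"
  obtains d where "\<And>i. (v, i) \<in> E ^^ d i"
proof -
  have "\<exists>n. (v, i) \<in> E ^^ n" for i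
    using assms by (cases "i = v") (auto simp: root_node_def intro: exI[of _ 0] dest: trancl_into_rtrancl rtrancl_imp_relpow)
  then show ?thesis using that by metis
qed

text \<open>
  Let \<open>m\<close> and \<open>M\<close> be the initial minimum and maximum. The growth estimate for \<open>y - m\<close>
  lifts every node above \<open>m\<close> by \<open>c (y\<^sub>v - m)\<close>; applied to \<open>M - y\<close> it lowers every node by
  \<open>c (M - y\<^sub>v)\<close>. Wherever the root lies, the two gains add up to \<open>c (M - m)\<close>. The factor \<open>c\<close> depends
  only on the graph and on the weight bounds.
\<close>

lemma consensus_contraction:
  fixes E :: "('m::finite \<times> 'm) set"
  assumes "root_node E v" "lo > 0"
  shows "\<exists>q. 1/2 \<le> q \<and> q < 1 \<and> (\<forall>b y D. consensus b y \<longrightarrow> weights_between E lo hi b \<longrightarrow>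
    (\<forall>i j. y 0 i - y 0 j \<le> D) \<longrightarrow> (\<forall>i j. y 1 i - y 1 j \<le> q * D))"
proof -
  obtain d where d: "\<And>i. (v, i) \<in> E ^^ d i" using root_node_relpow[OF assms(1)] by blast
  define c where "c = Min (insert 1 (range (\<lambda>i. lo ^ d i / fact (d i) / exp (real CARD('m) * hi))))"
  have c: "c > 0" "c \<le> 1" using assms(2) by (auto simp: c_def)
  have c_le: "c \<le> lo ^ d i / fact (d i) / exp (real CARD('m) * hi)" for i
    unfolding c_def by (intro Min_le) auto
  \<comment> \<open>Inserting \<open>1\<close> above keeps the contraction factor \<open>1 - c/2\<close> at or above \<open>1/2\<close>.\<close>
  have gap: "y 1 j \<ge> m + c * (y 0 v - m)"
    if "consensus b y" "weights_between E lo hi b" "\<And>i. m \<le> y 0 i" for b y m j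
  proof -
    have "(y 0 v + - m) * (lo * 1) ^ d j / fact (d j) \<le> exp (real CARD('m) * hi * 1) * (y 1 j + - m)"
      by (rule consensus_path_growth[OF consensus_add_const[OF that(1)] that(2)])
        (use assms(2) that(3) d in auto)
    then have "(y 0 v - m) * (lo ^ d j / fact (d j) / exp (real CARD('m) * hi)) \<le> y 1 j - m"
      by (simp add: field_simps)
    moreover have "(y 0 v - m) * c \<le> (y 0 v - m) * (lo ^ d j / fact (d j) / exp (real CARD('m) * hi))"
      using that(3) c_le by (intro mult_left_mono) auto
    ultimately show ?thesis by (simp add: mult.commute)
  qed
  have "y 1 i - y 1 j \<le> (1 - c/2) * D"
    if y: "consensus b y" and b: "weights_between E lo hi b" and D: "\<And>i j. y 0 i - y 0 j \<le> D" for b y D i j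
  proof -
    define m where "m = Min (range (y 0))"
    define M where "M = Max (range (y 0))"
    have mM: "m \<le> y 0 i" "y 0 i \<le> M" for i by (auto simp: m_def M_def)
    have "m \<in> range (y 0)" "M \<in> range (y 0)" unfolding m_def M_def by (auto intro: Min_in Max_in)
    with D have "M - m \<le> D" by auto
    have bounds: "m + c * (y 0 v - m) \<le> y 1 l" "y 1 l \<le> M - c * (M - y 0 v)" for l
      using gap[OF y b mM(1), of l] gap[OF consensus_uminus[OF y] b, of "- M" l] mM(2)
      by (auto simp: algebra_simps)
    have "y 1 i - y 1 j \<le> (1 - c) * (M - m)"
      using bounds(1)[of j] bounds(2)[of i] by (simp add: algebra_simps)
    also have "\<dots> \<le> (1 - c/2) * D"
      using \<open>M - m \<le> D\<close> c mM[of v] by (intro mult_mono) auto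
    finally show ?thesis .
  qed
  then show ?thesis using c by (intro exI[of _ "1 - c/2"]) auto
qed

lemma norm_le_of_inner_le:
  fixes x :: "'a::real_inner"
  assumes "\<And>w. norm w = 1 \<Longrightarrow> w \<bullet> x \<le> c" "c \<ge> 0"
  shows "norm x \<le> c"
proof (cases "x = 0")
  case False
  then have "sgn x \<bullet> x \<le> c" by (intro assms) (simp add: norm_sgn)
  moreover have "sgn x \<bullet> x = norm x"
    using False by (simp add: sgn_div_norm power2_norm_eq_inner[symmetric] power2_eq_square)
  ultimately show ?thesis by simp
qed (use assms in simp)

text \<open>
  Contraction in every direction \<open>w\<close> contracts all mutual distances, so they shrink by \<open>q\<close> per
  unit of time and do not grow in between. A real time \<open>t\<close> may exceed the last integer by up to
  one, which costs a factor \<open>1/q \<le> 2\<close>. The rate is chosen before the solution and its weights;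
  this uniformity is what the restart argument needs.
\<close>

lemma consensus_exponential:
  fixes E :: "('m::finite \<times> 'm) set"
  assumes "root_node E v" "lo > 0"
  shows "\<exists>\<gamma>>0. \<forall>b (x :: real \<Rightarrow> 'm \<Rightarrow> 'a::real_inner) D.
    (\<forall>w. consensus b (\<lambda>t i. w \<bullet> x t i)) \<longrightarrow> weights_between E lo hi b \<longrightarrow>
    (\<forall>i j. norm (x 0 i - x 0 j) \<le> D) \<longrightarrow>
    (\<forall>t\<ge>0. \<forall>i j. norm (x t i - x t j) \<le> 2 * D * exp (- \<gamma> * t))"
proof -
  obtain q where q: "1/2 \<le> q" "q < 1"
    and contr: "\<And>b y D i j. \<lbrakk>consensus b y; weights_between E lo hi b; \<forall>i j. y 0 i - y 0 j \<le> D\<rbrakk>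
        \<Longrightarrow> y 1 i - y 1 j \<le> q * D"
    using consensus_contraction[OF assms, of hi] by metis
  have rate: "norm (x t i - x t j) \<le> 2 * D * exp (ln q * t)"
    if x: "\<And>w. consensus b (\<lambda>t i. w \<bullet> x t i)" and b: "weights_between E lo hi b"
      and D: "\<And>i j. norm (x 0 i - x 0 j) \<le> D" and "t \<ge> 0"
    for b and x :: "real \<Rightarrow> 'm \<Rightarrow> 'a" and D t i j
  proof -
    have D0: "D \<ge> 0" using D[of i i] by simp
    have inner_le: "w \<bullet> x s i - w \<bullet> x s j \<le> C"
      if "norm w = 1" "norm (x s i - x s j) \<le> C" for w s i j C
      using norm_cauchy_schwarz[of w "x s i - x s j"] that by (simp add: inner_diff_right)
    have step: "norm (x (real n) i - x (real n) j) \<le> q ^ n * D" for n i j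
    proof (induction n arbitrary: i j)
      case (Suc n)
      show ?case
      proof (rule norm_le_of_inner_le)
        fix w :: 'a assume w: "norm w = 1"
        have "w \<bullet> x (real n + 1) i - w \<bullet> x (real n + 1) j \<le> q * (q ^ n * D)"
          using contr[OF consensus_shift[OF x[of w], of "real n"] weights_between_shift[OF b, of "real n"], of "q ^ n * D" i j]
            inner_le[OF w Suc.IH] by simp
        then show "w \<bullet> (x (real (Suc n)) i - x (real (Suc n)) j) \<le> q ^ Suc n * D"
          by (simp add: inner_diff_right add.commute mult.assoc)
      qed (use q D0 in simp)
    qed (simp add: D)
    define n where "n = nat \<lfloor>t\<rfloor>"
    define s where "s = t - real n"
    have n: "real n \<le> t" "t < real n + 1" using \<open>t \<ge> 0\<close> by (auto simp: n_def)
    then have t: "t = real n + s" "s \<ge> 0" by (auto simp: s_def)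
    have "norm (x t i - x t j) \<le> q ^ n * D"
    proof (rule norm_le_of_inner_le)
      fix w :: 'a assume w: "norm w = 1"
      note cs = consensus_shift[OF x[of w], of "real n"] and bs = weights_between_shift[OF b, of "real n"]
      define m where "m = Min (range (\<lambda>l. w \<bullet> x (real n) l))"
      define M where "M = Max (range (\<lambda>l. w \<bullet> x (real n) l))"
      have "m \<in> range (\<lambda>l. w \<bullet> x (real n) l)" "M \<in> range (\<lambda>l. w \<bullet> x (real n) l)"
        unfolding m_def M_def by (auto intro: Min_in Max_in)
      then have "M - m \<le> q ^ n * D" using inner_le[OF w step[of n]] by auto
      moreover have "w \<bullet> x t i \<le> M"
        unfolding t(1) by (rule consensus_upper_bound[OF cs bs]) (use t(2) in \<open>auto simp: M_def\<close>)
      moreover have "w \<bullet> x t j \<ge> m"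
        unfolding t(1) by (rule consensus_lower_bound[OF cs bs]) (use t(2) in \<open>auto simp: m_def\<close>)
      ultimately show "w \<bullet> (x t i - x t j) \<le> q ^ n * D" by (simp add: inner_diff_right)
    qed (use q D0 in simp)
    also have "q ^ n \<le> 2 * exp (ln q * t)"
    proof -
      have "q ^ n = exp (ln q * real n)" using q by (simp add: exp_of_nat2_mult)
      also have "\<dots> \<le> exp (ln q * (t - 1))"
        using n q by (simp add: mult_left_mono_neg)
      also have "\<dots> = exp (ln q * t) / q" using q by (simp add: right_diff_distrib exp_diff)
      also have "\<dots> \<le> exp (ln q * t) / (1/2)" using q by (intro divide_left_mono) auto
      finally show ?thesis by simp
    qed
    finally show ?thesis using D0 by (simp add: mult_right_mono mult.commute mult.left_commute)
  qed
  show ?thesis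
  proof (intro exI[of _ "- ln q"] conjI allI impI)
    show "norm (x t i - x t j) \<le> 2 * D * exp (- (- ln q) * t)"
      if "\<forall>w. consensus b (\<lambda>t i. w \<bullet> x t i)" "weights_between E lo hi b"
        "\<forall>i j. norm (x 0 i - x 0 j) \<le> D" "t \<ge> 0" for b and x :: "real \<Rightarrow> 'm \<Rightarrow> 'a" and D t i j
      using rate[OF that(1)[rule_format] that(2) that(3)[rule_format] that(4)] by simp
  qed (use q in simp)
qed

section \<open>The Kuramoto model on an open hemisphere\<close>

lemma kuramoto_norm:
  assumes "kuramoto_solution k A r" "t \<ge> 0"
  shows "norm (r t $ i) = 1"
  using assms by (auto simp: kuramoto_solution_def)

lemma kuramoto_inner_derivative:
  fixes r :: "real \<Rightarrow> (real^'n::finite)^'m::finite"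
  assumes "kuramoto_solution k A r" "t \<ge> 0"
  shows "((\<lambda>s. w \<bullet> r s $ i) has_real_derivative
    (\<Sum>j\<in>UNIV. k * A $ i $ j * (w \<bullet> r t $ j - (r t $ i \<bullet> r t $ j) * (w \<bullet> r t $ i)))) (at t within {0..})"
proof -
  have "((\<lambda>s. r s $ i) has_vector_derivative
      k *\<^sub>R (\<Sum>j\<in>UNIV. A $ i $ j *\<^sub>R (r t $ j - (r t $ i \<bullet> r t $ j) *\<^sub>R r t $ i))) (at t within {0..})"
    using assms by (auto simp: kuramoto_solution_def)
  from bounded_linear.has_vector_derivative[OF bounded_linear_inner_right this, of w]
  show ?thesis
    by (simp add: has_real_derivative_iff_has_vector_derivative inner_sum_right inner_diff_right
        sum_distrib_left mult.assoc)
qed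

lemma kuramoto_shift:
  assumes "kuramoto_solution k A r" "a \<ge> 0"
  shows "kuramoto_solution k A (\<lambda>t. r (a + t))"
  unfolding kuramoto_solution_def
proof (intro allI impI conjI)
  fix t :: real and i assume "t \<ge> 0"
  with assms have "a + t \<ge> 0" by simp
  then show "norm (r (a + t) $ i) = 1" by (rule kuramoto_norm[OF assms(1)])
  show "((\<lambda>s. r (a + s) $ i) has_vector_derivative
      k *\<^sub>R (\<Sum>j\<in>UNIV. A $ i $ j *\<^sub>R
        (r (a + t) $ j - (r (a + t) $ i \<bullet> r (a + t) $ j) *\<^sub>R r (a + t) $ i)))
      (at t within {0..})"
    using assms \<open>a + t \<ge> 0\<close> unfolding kuramoto_solution_def
    by (intro has_vector_derivative_shift_halfline) auto
qed

lemma inner_unit_le_1: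
  fixes x y :: "'a::real_inner"
  assumes "norm x = 1" "norm y = 1"
  shows "x \<bullet> y \<le> 1"
  using norm_cauchy_schwarz[of x y] assms by simp

text \<open>
  At a lowest oscillator with \<open>h\<^sub>i > 0\<close> each summand satisfies
  \<open>h\<^sub>j - (r\<^sub>i \<bullet> r\<^sub>j) h\<^sub>i \<ge> h\<^sub>j - h\<^sub>i \<ge> 0\<close>. Positivity is essential for the first inequality, which is
  why the minimum principle is applied to \<open>h\<^sub>i - \<delta>\<close> with margin \<open>\<eta> = \<delta>\<close>.
\<close>

lemma kuramoto_hemisphere_invariant:
  fixes r :: "real \<Rightarrow> (real^'n::finite)^'m::finite"
  assumes sol: "kuramoto_solution k A r" and "k > 0" and A: "\<And>i j. A $ i $ j \<ge> 0"
    and "\<delta> > 0" and init: "\<And>i. v \<bullet> r 0 $ i \<ge> \<delta>" and "t \<ge> 0"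
  shows "v \<bullet> r t $ i \<ge> \<delta>"
proof -
  have "v \<bullet> r t $ i + (- \<delta>) \<ge> 0"
  proof (rule minimum_principle[where \<eta> = \<delta> and u = "\<lambda>t i. v \<bullet> r t $ i + (- \<delta>)"])
    fix t :: real and i assume "t \<ge> 0"
    let ?d = "\<Sum>j\<in>UNIV. k * A $ i $ j * (v \<bullet> r t $ j - (r t $ i \<bullet> r t $ j) * (v \<bullet> r t $ i))"
    show "((\<lambda>s. v \<bullet> r s $ i + - \<delta>) has_real_derivative ?d) (at t within {0..})"
      by (auto intro!: derivative_eq_intros kuramoto_inner_derivative[OF sol \<open>t \<ge> 0\<close>])
    assume pos: "- \<delta> < v \<bullet> r t $ i + - \<delta>" and minimal: "\<forall>j. v \<bullet> r t $ i + - \<delta> \<le> v \<bullet> r t $ j + - \<delta>"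
    have "(r t $ i \<bullet> r t $ j) * (v \<bullet> r t $ i) \<le> 1 * (v \<bullet> r t $ i)" for j
      using pos inner_unit_le_1[OF kuramoto_norm[OF sol \<open>t \<ge> 0\<close>] kuramoto_norm[OF sol \<open>t \<ge> 0\<close>]]
      by (intro mult_right_mono) auto
    moreover have "v \<bullet> r t $ i \<le> v \<bullet> r t $ j" for j using minimal by simp
    ultimately have "(r t $ i \<bullet> r t $ j) * (v \<bullet> r t $ i) \<le> v \<bullet> r t $ j" for j
      by (simp add: order_trans[of _ "v \<bullet> r t $ i"])
    then show "?d \<ge> 0"
      using A \<open>k > 0\<close> by (intro sum_nonneg mult_nonneg_nonneg) auto
  qed (use assms in auto)
  then show ?thesis by simp
qed

text \<open>
  In the quotient rule for \<open>(w \<bullet> r\<^sub>i) / h\<^sub>i\<close> the numerator is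
  \<open>(w \<bullet> r\<^sub>j - c (w \<bullet> r\<^sub>i)) h\<^sub>i - (w \<bullet> r\<^sub>i) (h\<^sub>j - c h\<^sub>i)\<close> with \<open>c = r\<^sub>i \<bullet> r\<^sub>j\<close>, and the two terms with \<open>c\<close>
  cancel: they come from the radial part of the dynamics, which central projection does not see.
\<close>

lemma kuramoto_gnomonic_consensus:
  fixes r :: "real \<Rightarrow> (real^'n::finite)^'m::finite"
  assumes sol: "kuramoto_solution k A r" and pos: "\<And>t i. t \<ge> 0 \<Longrightarrow> v \<bullet> r t $ i > 0"
  shows "consensus (\<lambda>t i j. k * A $ i $ j * (v \<bullet> r t $ j) / (v \<bullet> r t $ i))
    (\<lambda>t i. w \<bullet> (r t $ i /\<^sub>R (v \<bullet> r t $ i)))"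
  unfolding consensus_def
proof (intro allI impI)
  fix t :: real and i assume t: "t \<ge> 0"
  let ?h = "\<lambda>j. v \<bullet> r t $ j" and ?g = "\<lambda>j. w \<bullet> r t $ j" and ?c = "\<lambda>j. r t $ i \<bullet> r t $ j"
  have h: "?h j \<noteq> 0" for j using pos[OF t, of j] by simp
  have "((\<lambda>s. (w \<bullet> r s $ i) / (v \<bullet> r s $ i)) has_real_derivative
    ((\<Sum>j\<in>UNIV. k * A $ i $ j * (?g j - ?c j * ?g i)) * ?h i
      - ?g i * (\<Sum>j\<in>UNIV. k * A $ i $ j * (?h j - ?c j * ?h i))) / (?h i * ?h i)) (at t within {0..})"
    by (intro DERIV_divide kuramoto_inner_derivative[OF sol t] h)
  moreover have "((\<Sum>j\<in>UNIV. k * A $ i $ j * (?g j - ?c j * ?g i)) * ?h i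
      - ?g i * (\<Sum>j\<in>UNIV. k * A $ i $ j * (?h j - ?c j * ?h i))) / (?h i * ?h i)
    = (\<Sum>j\<in>UNIV. k * A $ i $ j * ?h j / ?h i * (?g j / ?h j - ?g i / ?h i))"
    unfolding sum_distrib_left sum_distrib_right sum_subtractf[symmetric] sum_divide_distrib
    using h by (intro sum.cong refl) (simp add: field_simps)
  ultimately show "((\<lambda>s. w \<bullet> (r s $ i /\<^sub>R (v \<bullet> r s $ i))) has_real_derivative
     (\<Sum>j\<in>UNIV. k * A $ i $ j * ?h j / ?h i * (w \<bullet> (r t $ j /\<^sub>R ?h j) - w \<bullet> (r t $ i /\<^sub>R ?h i)))) (at t within {0..})"
    by (simp add: divide_inverse mult.commute)
qed

text \<open>
  Expanding, the square of the right-hand side equals \<open>(a - b)\<^sup>2 + 2 a b (1 - x \<bullet> y)\<close>, that of the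
  left-hand side is \<open>2 (1 - x \<bullet> y)\<close>.
\<close>

lemma norm_diff_unit_le_scaled:
  fixes x y :: "'a::real_inner"
  assumes "norm x = 1" "norm y = 1" "a \<ge> 1" "b \<ge> 1"
  shows "norm (x - y) \<le> norm (a *\<^sub>R x - b *\<^sub>R y)"
proof (rule power2_le_imp_le)
  have xy: "x \<bullet> x = 1" "y \<bullet> y = 1" using assms by (auto simp: power2_norm_eq_inner[symmetric])
  have "2 * (1 - x \<bullet> y) * 1 \<le> 2 * (1 - x \<bullet> y) * (a * b)"
    using inner_unit_le_1[OF assms(1,2)] mult_mono[of 1 a 1 b] assms
    by (intro mult_left_mono) auto
  also have "\<dots> \<le> 2 * (1 - x \<bullet> y) * (a * b) + (a - b)\<^sup>2" by simp
  finally show "(norm (x - y))\<^sup>2 \<le> (norm (a *\<^sub>R x - b *\<^sub>R y))\<^sup>2"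
    unfolding power2_norm_eq_inner
    by (simp add: inner_diff_left inner_diff_right xy inner_commute[of y x] power2_eq_square algebra_simps)
qed simp

text \<open>
  With all heights in \<open>[\<delta>, 1]\<close> the quotients \<open>h\<^sub>j / h\<^sub>i\<close> lie in \<open>[\<delta>, 1/\<delta>]\<close>, which bounds the weights
  of the projected system, and the projected points lie outside the unit ball at distance at most
  \<open>1/\<delta>\<close> from the origin. Hence their initial distances are at most \<open>2/\<delta>\<close>.
\<close>

lemma kuramoto_rate_on_cap:
  fixes E :: "('m::finite \<times> 'm) set" and A :: "real^'m^'m"
  assumes "k > 0" "weighted_digraph E A" "root_node E v0" "\<delta> > 0"
  shows "\<exists>\<gamma>>0. \<forall>(r :: real \<Rightarrow> (real^'n::finite)^'m) v. kuramoto_solution k A r \<longrightarrow> norm v = 1 \<longrightarrow>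
    (\<forall>i. v \<bullet> r 0 $ i \<ge> \<delta>) \<longrightarrow>
    (\<forall>t\<ge>0. \<forall>i j. norm (r t $ i - r t $ j) \<le> 4 / \<delta> * exp (- \<gamma> * t))"
proof -
  have A: "A $ i $ j \<ge> 0" for i j
    using assms(2) unfolding weighted_digraph_def by (metis less_imp_le order_refl)
  \<comment> \<open>The inserted \<open>1\<close> makes the minimum positive when the graph has no edges (a single node).\<close>
  define al where "al = Min (insert 1 ((\<lambda>(j, i). A $ i $ j) ` E))"
  define ah where "ah = Max ((\<lambda>(i, j). A $ i $ j) ` UNIV)"
  have "al > 0" using assms(2) by (auto simp: al_def weighted_digraph_def)
  have al: "al \<le> A $ i $ j" if "(j, i) \<in> E" for i j
    unfolding al_def using that by (intro Min_le) force+
  have ah: "A $ i $ j \<le> ah" for i j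
    unfolding ah_def by (intro Max_ge) force+
  obtain \<gamma> where "\<gamma> > 0" and lam: "\<And>b (x :: real \<Rightarrow> 'm \<Rightarrow> real^'n) D t i j.
    \<lbrakk>\<And>w. consensus b (\<lambda>t i. w \<bullet> x t i); weights_between E (k * al * \<delta>) (k * ah / \<delta>) b;
    \<And>i j. norm (x 0 i - x 0 j) \<le> D; t \<ge> 0\<rbrakk> \<Longrightarrow> norm (x t i - x t j) \<le> 2 * D * exp (- \<gamma> * t)"
    using consensus_exponential[OF assms(3), of "k * al * \<delta>" "k * ah / \<delta>", where 'a = "real^'n"]
      assms(1,4) \<open>al > 0\<close> by (metis mult_pos_pos)
  have "norm (r t $ i - r t $ j) \<le> 4 / \<delta> * exp (- \<gamma> * t)"
    if sol: "kuramoto_solution k A r" and v: "norm v = 1" and init: "\<And>i. v \<bullet> r 0 $ i \<ge> \<delta>" and "t \<ge> 0"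
    for r :: "real \<Rightarrow> (real^'n)^'m" and v t i j
  proof -
    have lower: "v \<bullet> r t $ i \<ge> \<delta>" if "t \<ge> 0" for t i
      by (rule kuramoto_hemisphere_invariant[OF sol assms(1) A assms(4) init that])
    have upper: "v \<bullet> r t $ i \<le> 1" if "t \<ge> 0" for t i
      by (rule inner_unit_le_1[OF v kuramoto_norm[OF sol that]])
    have pos: "v \<bullet> r t $ i > 0" if "t \<ge> 0" for t i using lower[OF that, of i] assms(4) by linarith
    define x where "x t i = r t $ i /\<^sub>R (v \<bullet> r t $ i)" for t i
    have wb: "weights_between E (k * al * \<delta>) (k * ah / \<delta>) (\<lambda>t i j. k * A $ i $ j * (v \<bullet> r t $ j) / (v \<bullet> r t $ i))"
      unfolding weights_between_def
    proof (intro allI impI conjI)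
      fix t :: real and i j assume t: "t \<ge> 0"
      note * = lower[OF t] upper[OF t] pos[OF t]
      show "0 \<le> k * A $ i $ j * (v \<bullet> r t $ j) / (v \<bullet> r t $ i)"
        using *(3) assms(1) A by (intro divide_nonneg_pos mult_nonneg_nonneg) (auto intro: less_imp_le)
      have "ah \<ge> 0" using A[of i j] ah[of i j] by linarith
      have "k * A $ i $ j * (v \<bullet> r t $ j) \<le> k * ah * 1"
        using assms(1) A ah *(2,3) \<open>ah \<ge> 0\<close> by (intro mult_mono) (auto intro: less_imp_le)
      then show "k * A $ i $ j * (v \<bullet> r t $ j) / (v \<bullet> r t $ i) \<le> k * ah / \<delta>"
        using *(1) assms(1,4) \<open>ah \<ge> 0\<close> by (intro frac_le) auto
      assume ji: "(j, i) \<in> E"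
      have "k * al * \<delta> \<le> k * A $ i $ j * (v \<bullet> r t $ j)"
        using assms(1,4) al[OF ji] \<open>al > 0\<close> *(1) A by (intro mult_mono) auto
      also have "\<dots> \<le> k * A $ i $ j * (v \<bullet> r t $ j) / (v \<bullet> r t $ i)"
        using *(2)[of i] *(3)[of i] mult_left_mono[of "v \<bullet> r t $ i" 1 "k * A $ i $ j * (v \<bullet> r t $ j)"]
          assms(1) A *(3)[of j] by (simp add: le_divide_eq less_imp_le)
      finally show "k * al * \<delta> \<le> k * A $ i $ j * (v \<bullet> r t $ j) / (v \<bullet> r t $ i)" .
    qed
    have norm_x0: "norm (x 0 i) \<le> 1 / \<delta>" for i
      using lower[of 0 i] pos[of 0 i] assms(4) kuramoto_norm[OF sol, of 0 i]
      by (simp add: x_def divide_simps)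
    have D: "norm (x 0 i - x 0 j) \<le> 2 / \<delta>" for i j
      using norm_triangle_ineq4[of "x 0 i" "x 0 j"] norm_x0[of i] norm_x0[of j] by simp
    have "norm (r t $ i - r t $ j) \<le> norm (x t i - x t j)"
      unfolding x_def using upper[OF \<open>t \<ge> 0\<close>] pos[OF \<open>t \<ge> 0\<close>]
      by (intro norm_diff_unit_le_scaled kuramoto_norm[OF sol \<open>t \<ge> 0\<close>]) (auto simp: one_le_inverse)
    also have "\<dots> \<le> 2 * (2 / \<delta>) * exp (- \<gamma> * t)"
      by (rule lam[OF kuramoto_gnomonic_consensus[OF sol pos, folded x_def] wb D \<open>t \<ge> 0\<close>])
    finally show ?thesis by simp
  qed
  then show ?thesis using \<open>\<gamma> > 0\<close> by blast
qed

text \<open>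
  The restart: at time \<open>T\<close> the bound for the given initial state has come down to \<open>1\<close>, and unit vectors
  at distance at most \<open>1\<close> have inner product at least \<open>1/2\<close>. The time-shifted trajectory then
  satisfies the hypothesis for \<open>\<delta> = 1/2\<close> with an oscillator's own position at time \<open>T\<close> as \<open>v\<close>. The constant
  is built from \<open>r0\<close> alone, before the trajectory is given.
\<close>

lemma kuramoto_uniform_rate:
  fixes r0 :: "(real^'n::finite)^'m::finite" and A :: "real^'m^'m"
  assumes "k > 0" "weighted_digraph E A" "root_node E v0"
    and cap: "\<forall>(r :: real \<Rightarrow> (real^'n)^'m) v. kuramoto_solution k A r \<longrightarrow> norm v = 1 \<longrightarrow>
      (\<forall>i. v \<bullet> r 0 $ i \<ge> 1/2) \<longrightarrow>
      (\<forall>t\<ge>0. \<forall>i j. norm (r t $ i - r t $ j) \<le> 4 / (1/2) * exp (- \<mu> * t))"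
    and "\<mu> > 0"
    and hemi: "\<And>i. v \<bullet> r0 $ i > 0"
  shows "\<exists>a. \<forall>r. kuramoto_solution k A r \<longrightarrow> r 0 = r0 \<longrightarrow>
    (\<forall>t\<ge>0. \<forall>i j. norm (r t $ i - r t $ j) \<le> a * exp (- \<mu> * t))"
proof -
  have "v \<noteq> 0" using hemi by force
  define \<delta> where "\<delta> = Min (range (\<lambda>i. sgn v \<bullet> r0 $ i))"
  have "\<delta> > 0" using hemi \<open>v \<noteq> 0\<close> by (auto simp: \<delta>_def sgn_div_norm)
  have \<delta>: "\<delta> \<le> sgn v \<bullet> r0 $ i" for i by (auto simp: \<delta>_def)
  obtain \<gamma> where "\<gamma> > 0" and lam: "\<And>(r :: real \<Rightarrow> (real^'n)^'m) v t i j. \<lbrakk>kuramoto_solution k A r; norm v = 1;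
      \<And>i. v \<bullet> r 0 $ i \<ge> \<delta>; t \<ge> 0\<rbrakk> \<Longrightarrow> norm (r t $ i - r t $ j) \<le> 4 / \<delta> * exp (- \<gamma> * t)"
    using kuramoto_rate_on_cap[OF assms(1-3) \<open>\<delta> > 0\<close>, where 'n = 'n] by metis
  define T where "T = max 0 (ln (4 / \<delta>) / \<gamma>)"
  have T: "T \<ge> 0" "4 / \<delta> * exp (- \<gamma> * T) \<le> 1"
  proof -
    have "ln (4 / \<delta>) \<le> \<gamma> * T" using \<open>\<gamma> > 0\<close> by (auto simp: T_def max_def field_simps)
    then have "exp (ln (4 / \<delta>)) \<le> exp (\<gamma> * T)" by simp
    then show "4 / \<delta> * exp (- \<gamma> * T) \<le> 1" using \<open>\<delta> > 0\<close> by (simp add: exp_minus field_simps)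
  qed (simp add: T_def)
  have "norm (r t $ i - r t $ j) \<le> 8 * exp (\<mu> * T) * exp (- \<mu> * t)"
    if sol: "kuramoto_solution k A r" and r0: "r 0 = r0" and "t \<ge> 0" for r t i j
  proof -
    have split: "8 * exp (\<mu> * T) * exp (- \<mu> * t) = 8 * exp (- \<mu> * (t - T))"
      by (simp add: exp_add[symmetric] algebra_simps)
    show ?thesis
    proof (cases "t \<le> T")
      case True
      have "norm (r t $ i - r t $ j) \<le> 2"
        using norm_triangle_ineq4[of "r t $ i" "r t $ j"] kuramoto_norm[OF sol \<open>t \<ge> 0\<close>] by simp
      also have "\<dots> \<le> 8 * exp (- \<mu> * (t - T))"
      proof -
        have "- \<mu> * (t - T) \<ge> 0" using True \<open>\<mu> > 0\<close> by (simp add: mult_nonneg_nonpos)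
        then have "exp (- \<mu> * (t - T)) \<ge> 1" by simp
        then show ?thesis by linarith
      qed
      finally show ?thesis using split by simp
    next
      case False
      have near: "r T $ j \<bullet> r T $ l \<ge> 1/2" for l
      proof -
        have "norm (r T $ j - r T $ l) \<le> 1"
          using lam[OF sol _ _ T(1), of "sgn v" j l] T(2) \<delta> r0 \<open>v \<noteq> 0\<close> by (simp add: norm_sgn)
        then have "(norm (r T $ j - r T $ l))\<^sup>2 \<le> 1" by (simp add: power_le_one)
        moreover have "(norm (r T $ l))\<^sup>2 = 1" for l using kuramoto_norm[OF sol T(1)] by simp
        ultimately show ?thesis
          unfolding power2_norm_eq_inner by (simp add: inner_diff_left inner_diff_right inner_commute)
      qed
      have "norm (r (T + (t - T)) $ i - r (T + (t - T)) $ j) \<le> 4 / (1/2) * exp (- \<mu> * (t - T))"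
        by (rule cap[rule_format, OF kuramoto_shift[OF sol T(1)], of "r T $ j"])
          (use near kuramoto_norm[OF sol T(1)] False in auto)
      then show ?thesis using split by simp
    qed
  qed
  then show ?thesis by blast
qed

text \<open>
  The rate for the height \<open>1/2\<close> is fixed before any initial state is considered; only the
  constant is then chosen for each initial state separately.
\<close>

theorem theorem3p3:
  fixes E :: "('m::finite \<times> 'm) set"
    and A :: "real^'m^'m"
    and k :: real
  assumes "k > 0"
    and "weighted_digraph E A"
    and "has_directed_spanning_tree E"
  shows "\<exists>\<mu>>0. \<exists>\<alpha> :: (real^'n::finite)^'m \<Rightarrow> real.
           \<forall>r :: real \<Rightarrow> (real^'n)^'m.
             kuramoto_solution k A r \<longrightarrow>
             (\<exists>v :: real^'n. \<forall>i. v \<bullet> r 0 $ i > 0) \<longrightarrow>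
             (\<forall>t\<ge>0. \<forall>i j. norm (r t $ i - r t $ j) \<le> \<alpha> (r 0) * exp (- \<mu> * t))"
proof -
  obtain v0 where root: "root_node E v0"
    using assms(3) unfolding has_directed_spanning_tree_iff_root_node ..
  obtain \<mu> where "\<mu> > 0" and cap: "\<forall>(r :: real \<Rightarrow> (real^'n)^'m) v. kuramoto_solution k A r \<longrightarrow> norm v = 1 \<longrightarrow>
      (\<forall>i. v \<bullet> r 0 $ i \<ge> 1/2) \<longrightarrow>
      (\<forall>t\<ge>0. \<forall>i j. norm (r t $ i - r t $ j) \<le> 4 / (1/2) * exp (- \<mu> * t))"
    using kuramoto_rate_on_cap[OF assms(1,2) root, of "1/2", where 'n = 'n] half_gt_zero_iff zero_less_one
    by metis
  have "\<forall>r0 :: (real^'n)^'m. \<exists>a. (\<exists>v. \<forall>i. v \<bullet> r0 $ i > 0) \<longrightarrow>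
      (\<forall>r. kuramoto_solution k A r \<longrightarrow> r 0 = r0 \<longrightarrow>
        (\<forall>t\<ge>0. \<forall>i j. norm (r t $ i - r t $ j) \<le> a * exp (- \<mu> * t)))"
    using kuramoto_uniform_rate[OF assms(1,2) root cap \<open>\<mu> > 0\<close>] by blast
  from choice[OF this] obtain \<alpha> where "\<forall>r0 :: (real^'n)^'m. (\<exists>v. \<forall>i. v \<bullet> r0 $ i > 0) \<longrightarrow>
      (\<forall>r. kuramoto_solution k A r \<longrightarrow> r 0 = r0 \<longrightarrow>
        (\<forall>t\<ge>0. \<forall>i j. norm (r t $ i - r t $ j) \<le> \<alpha> r0 * exp (- \<mu> * t)))"
    ..
  then show ?thesis using \<open>\<mu> > 0\<close> by blast
qed

end
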